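(* Let $C_{w,f}$ be a weighted composition operator on $L^p(\mu)$. If there exists a nonempty countable family $(B_i)_{i \in I}$ of measurable sets of finite positive $\mu$-measure such that \[ \liminf_{N \to \infty} \frac{1}{N} \sum_{n=1}^N \mu_n(f^{-n}(B_i))^{\frac{1}{p}} = 0 \quad \text{for all } i \in I \] and \[ \sup \Big\{\frac{1}{N} \sum_{n=1}^N \frac{\mu_n(f^{-n}(B_i))^{\frac{1}{p}}}{\mu(B_i)} : i \in I,\ N \in \mathbb{N} \Big\} = \infty, \] then $C_{w,f}$ is mean Li-Yorke chaotic.
   Context: Fix $\mathbb{K} = \mathbb{R}$ or $\mathbb{C}$, a real number $p \in [1,\infty)$ and an arbitrary positive measure space $(X,\mathfrak{M},\mu)$. $L^p(\mu)$ is the Banach space over $\mathbb{K}$ of all $\mathbb{K}$-valued $p$-integrable functions with norm $\|\varphi\|_p = (\int_X |\varphi|^p d\mu)^{1/p}$. A weighted composition operator on $L^p(\mu)$ is the map $C_{w,f}(\varphi) = (\varphi \circ f)\cdot w$, where $w : X \to \mathbb{K}$ is measurable with $\varphi\cdot w \in L^p(\mu)$ for all $\varphi \in L^p(\mu)$, $f : X \to X$ is bimeasurable (i.e. $f(B) \in \mathfrak{M}$ and $f^{-1}(B) \in \mathfrak{M}$ whenever $B \in \mathfrak{M}$), and there is a constant $c \in (0,\infty)$ such that $\int_B |w|^p d\mu \le c\,\mu(f(B))$ for every $B \in \mathfrak{M}$; these conditions make $C_{w,f}$ a well-defined bounded linear operator on $L^p(\mu)$. Put $w^{(1)} = w$,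 $w^{(n)} = (w\circ f^{n-1})\cdots(w\circ f)\cdot w$ for $n \ge 2$, and $\mu_n(B) = \int_B |w^{(n)}|^p d\mu$ for $B \in \mathfrak{M}$, $n \in \mathbb{N} = \{1,2,\ldots\}$. A map $g : M \to M$ on a metric space $(M,d)$ is mean Li-Yorke chaotic if there is an uncountable set $S \subset M$ such that for each pair $(x,y)$ of distinct points of $S$: $\liminf_{N\to\infty} \frac{1}{N}\sum_{n=1}^N d(g^n(x),g^n(y)) = 0$ and $\limsup_{N\to\infty} \frac{1}{N}\sum_{n=1}^N d(g^n(x),g^n(y)) > 0$.
   Formalization: In the supremum condition the denominator μ(B_i) is replaced by μ(B_i)^{1/p}; the printed condition fails for p>1 (X=ℕ, μ({i})=1/(i+1), f=id, w=1/2, p=2, B_i={i}), and the two agree for p=1. *)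

theory Defs
  imports "HOL-Analysis.Analysis"
begin

text \<open>
  The scalar field is a type of sort \<open>{real_normed_field, euclidean_space}\<close>.  Both \<open>real\<close> and
  \<open>complex\<close> have this sort, and up to isometric isomorphism there are no others (Gelfand--Mazur).
\<close>

section \<open>The space \<open>L\<^sup>p\<close>\<close>

definition Lp_functions :: "real \<Rightarrow> 'a measure \<Rightarrow> ('a \<Rightarrow> 'k::{real_normed_field, euclidean_space}) set" where
  "Lp_functions p M =
     {\<phi>. \<phi> \<in> borel_measurable M \<and> integrable M (\<lambda>x. norm (\<phi> x) powr p)}"

definition Lp_rel ::
    "real \<Rightarrow> 'a measure \<Rightarrow> (('a \<Rightarrow> 'k::{real_normed_field, euclidean_space}) \<times> ('a \<Rightarrow> 'k)) set" where
  "Lp_rel p M =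
     {(\<phi>, \<psi>). \<phi> \<in> Lp_functions p M \<and> \<psi> \<in> Lp_functions p M \<and> (AE x in M. \<phi> x = \<psi> x)}"

definition Lp_space ::
    "real \<Rightarrow> 'a measure \<Rightarrow> ('a \<Rightarrow> 'k::{real_normed_field, euclidean_space}) set set" where
  "Lp_space p M = Lp_functions p M // Lp_rel p M"

definition Lp_norm :: "real \<Rightarrow> 'a measure \<Rightarrow> ('a \<Rightarrow> 'k::{real_normed_field, euclidean_space}) \<Rightarrow> real" where
  "Lp_norm p M \<phi> = (\<integral>x. norm (\<phi> x) powr p \<partial>M) powr (1 / p)"

text \<open>The choice of representatives does not matter, since the norm respects equality a.e.\<close>

definition Lp_dist ::
    "real \<Rightarrow> 'a measure \<Rightarrow> ('a \<Rightarrow> 'k::{real_normed_field, euclidean_space}) set \<Rightarrow> ('a \<Rightarrow> 'k) set \<Rightarrow> real" where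
  "Lp_dist p M P Q = Lp_norm p M (\<lambda>x. (SOME \<phi>. \<phi> \<in> P) x - (SOME \<psi>. \<psi> \<in> Q) x)"

section \<open>Weighted composition operators\<close>

definition bimeasurable :: "'a measure \<Rightarrow> ('a \<Rightarrow> 'a) \<Rightarrow> bool" where
  "bimeasurable M f \<longleftrightarrow> f \<in> M \<rightarrow>\<^sub>M M \<and> (\<forall>B\<in>sets M. f ` B \<in> sets M)"

locale weighted_composition =
  fixes p :: real
    and M :: "'a measure"
    and w :: "'a \<Rightarrow> 'k::{real_normed_field, euclidean_space}"
    and f :: "'a \<Rightarrow> 'a"
  assumes p_ge_1: "1 \<le> p"
    and w_measurable: "w \<in> borel_measurable M"
    and w_multiplier: "\<And>\<phi>. \<phi> \<in> Lp_functions p M \<Longrightarrow> (\<lambda>x. \<phi> x * w x) \<in> Lp_functions p M"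
    and f_bimeasurable: "bimeasurable M f"
    and bounded: "\<exists>c::real. 0 < c \<and> (\<forall>B\<in>sets M.
           (\<integral>\<^sup>+x\<in>B. ennreal (norm (w x) powr p) \<partial>M) \<le> ennreal c * emeasure M (f ` B))"

text \<open>
  Composition with \<open>f\<close> respects equality a.e. on the support of \<open>w\<close> (by the integral bound in the
  locale), so all members of the union below coincide.
\<close>

definition wc_op ::
    "real \<Rightarrow> 'a measure \<Rightarrow> ('a \<Rightarrow> 'k::{real_normed_field, euclidean_space}) \<Rightarrow> ('a \<Rightarrow> 'a)
      \<Rightarrow> ('a \<Rightarrow> 'k) set \<Rightarrow> ('a \<Rightarrow> 'k) set" where
  "wc_op p M w f P = (\<Union>\<phi>\<in>P. Lp_rel p M `` {\<lambda>x. \<phi> (f x) * w x})"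

definition weight_iterate :: "('a \<Rightarrow> 'k::comm_monoid_mult) \<Rightarrow> ('a \<Rightarrow> 'a) \<Rightarrow> nat \<Rightarrow> 'a \<Rightarrow> 'k" where
  "weight_iterate w f n x = (\<Prod>k<n. w ((f ^^ k) x))"

definition weighted_measure ::
    "real \<Rightarrow> 'a measure \<Rightarrow> ('a \<Rightarrow> 'k::{real_normed_field, euclidean_space}) \<Rightarrow> ('a \<Rightarrow> 'a) \<Rightarrow> nat \<Rightarrow> 'a measure" where
  "weighted_measure p M w f n = density M (\<lambda>x. ennreal (norm (weight_iterate w f n x) powr p))"

text \<open>
  The real-valued \<open>measure\<close> may be used here: for a weighted composition operator and a set \<open>B\<close> of
  finite measure, the measure of the \<open>n\<close>-fold preimage of \<open>B\<close> is finite, and the quantity below is the norm of the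
  \<open>n\<close>-th iterate of the operator at the indicator function of \<open>B\<close>.

  Accordingly the theorem divides it by \<open>\<mu>(B) powr (1/p)\<close>, the norm of that indicator function.  The source
  prints the quotient with denominator \<open>\<mu>(B)\<close>; the two agree for \<open>p = 1\<close>, but for \<open>p > 1\<close> the printed
  hypothesis is not sufficient: take \<open>\<mu>({i}) = 1/(i+1)\<close> on the natural numbers, \<open>f = id\<close>, \<open>w = 1/2\<close>,
  \<open>B\<^sub>i = {i}\<close>.
\<close>

definition preimage_size ::
    "real \<Rightarrow> 'a measure \<Rightarrow> ('a \<Rightarrow> 'k::{real_normed_field, euclidean_space}) \<Rightarrow> ('a \<Rightarrow> 'a) \<Rightarrow> nat \<Rightarrow> 'a set \<Rightarrow> real" where
  "preimage_size p M w f n B =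
     measure (weighted_measure p M w f n) ((f ^^ n) -` B \<inter> space M) powr (1 / p)"

section \<open>Mean Li--Yorke chaos\<close>

definition mean_Li_Yorke_chaotic :: "'m set \<Rightarrow> ('m \<Rightarrow> 'm \<Rightarrow> real) \<Rightarrow> ('m \<Rightarrow> 'm) \<Rightarrow> bool" where
  "mean_Li_Yorke_chaotic X d g \<longleftrightarrow>
     (\<exists>S\<subseteq>X. uncountable S \<and>
       (\<forall>x\<in>S. \<forall>y\<in>S. x \<noteq> y \<longrightarrow>
          liminf (\<lambda>N. ereal ((\<Sum>n=1..N. d ((g ^^ n) x) ((g ^^ n) y)) / real N)) = 0 \<and>
          limsup (\<lambda>N. ereal ((\<Sum>n=1..N. d ((g ^^ n) x) ((g ^^ n) y)) / real N)) > 0))"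

end

theory Submission
  imports Defs
begin

text \<open>
  Write \<open>T\<close> for the operator, \<open>A\<^sub>N \<phi>\<close> for the mean of \<open>\<parallel>T\<^sup>n \<phi>\<parallel>\<close> over \<open>1 \<le> n \<le> N\<close>, and \<open>u\<^sub>i\<close> for the
  normalised indicator of \<open>B\<^sub>i\<close>.  If some \<open>\<phi>\<close> has \<open>liminf A\<^sub>N \<phi> = 0 < limsup A\<^sub>N \<phi>\<close>, then the real line spanned
  by \<open>\<phi>\<close> witnesses chaos.  Either some \<open>u\<^sub>i\<close> is such a vector, or \<open>A\<^sub>N u\<^sub>i \<longlonglongrightarrow> 0\<close> for every \<open>i\<close>.  In the latter
  case a sliding hump works: choose rapidly decreasing \<open>a\<^sub>k\<close>, indices \<open>i\<^sub>k\<close> and times \<open>m\<^sub>k\<close> such that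
  \<open>a\<^sub>k A\<^sub>N u\<^bsub>i\<^sub>k\<^esub> \<ge> 1\<close> for some \<open>N\<close> between \<open>m\<^sub>k\<close> and \<open>m\<^bsub>k+1\<^esub>\<close>, while all earlier and later terms are
  negligible at \<open>m\<^bsub>k+1\<^esub>\<close>.  The vector is
  \<open>(\<Sum>\<^sub>k (a\<^sub>k u\<^bsub>i\<^sub>k\<^esub>)\<^sup>p)\<^bsup>1/p\<^esup>\<close> rather than \<open>\<Sum>\<^sub>k a\<^sub>k u\<^bsub>i\<^sub>k\<^esub>\<close>: the \<open>p\<close>-th powers of the norms of its iterates are then
  exact sums, so neither Minkowski's inequality nor completeness of \<open>L\<^sup>p\<close> is needed.
\<close>

section \<open>Cesaro means and the sliding hump for scalar sequences\<close>

definition mean_upto :: "(nat \<Rightarrow> real) \<Rightarrow> nat \<Rightarrow> real" where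
  "mean_upto u N = (\<Sum>n=1..N. u n) / real N"

lemma mean_upto_mono:
  assumes "\<And>n. n \<in> {1..N} \<Longrightarrow> u n \<le> v n"
  shows "mean_upto u N \<le> mean_upto v N"
  unfolding mean_upto_def by (intro divide_right_mono sum_mono assms) auto

lemma mean_upto_nonneg: "(\<And>n. 0 \<le> u n) \<Longrightarrow> 0 \<le> mean_upto u N"
  unfolding mean_upto_def by (intro divide_nonneg_nonneg sum_nonneg) auto

lemma mean_upto_cmult: "mean_upto (\<lambda>n. c * u n) = (\<lambda>N. c * mean_upto u N)"
  by (simp add: fun_eq_iff mean_upto_def sum_distrib_left)

lemma mean_upto_add: "mean_upto (\<lambda>n. u n + v n) = (\<lambda>N. mean_upto u N + mean_upto v N)"
  by (simp add: fun_eq_iff mean_upto_def sum.distrib add_divide_distrib)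

lemma mean_upto_zero: "mean_upto (\<lambda>_. 0) = (\<lambda>_. 0)"
  by (simp add: fun_eq_iff mean_upto_def)

lemma mean_upto_const: "0 < N \<Longrightarrow> mean_upto (\<lambda>n. c) N = c"
  by (simp add: mean_upto_def)

lemma liminf_zero_if_small:
  fixes X :: "nat \<Rightarrow> real"
  assumes "\<And>N. 0 \<le> X N" and "strict_mono m" and "(\<lambda>k. X (m k)) \<longlonglongrightarrow> 0"
  shows "liminf (\<lambda>N. ereal (X N)) = 0"
proof (rule antisym)
  have "liminf (\<lambda>N. ereal (X N)) \<le> liminf ((\<lambda>N. ereal (X N)) \<circ> m)"
    by (rule liminf_subseq_mono[OF assms(2)])
  also have "\<dots> = 0"
  proof (rule lim_imp_Liminf)
    have "(\<lambda>k. ereal (X (m k))) \<longlonglongrightarrow> ereal 0"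
      using assms(3) by simp
    then show "((\<lambda>N. ereal (X N)) \<circ> m) \<longlonglongrightarrow> 0"
      by (simp add: o_def zero_ereal_def)
  qed simp
  finally show "liminf (\<lambda>N. ereal (X N)) \<le> 0" .
  show "0 \<le> liminf (\<lambda>N. ereal (X N))"
    by (rule Liminf_bounded) (simp add: assms(1))
qed

lemma limsup_ge_if_frequently:
  fixes X :: "nat \<Rightarrow> real"
  assumes "\<And>m. \<exists>N>m. c \<le> X N"
  shows "ereal c \<le> limsup (\<lambda>N. ereal (X N))"
proof (subst limsup_INF_SUP, rule INF_greatest)
  fix m :: nat
  obtain N where "N > m" "c \<le> X N" using assms by blast
  then show "ereal c \<le> (SUP N\<in>{m..}. ereal (X N))"
    by (intro SUP_upper2[of N]) auto
qed

text \<open>\<open>F\<close> is the sum of the terms chosen so far. The coefficient \<open>a\<close>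
  is so small that, by the growth bound, the new term stays below \<epsilon> up to time
  \<open>m\<close>. Since the means are unbounded over all indices, some sequence still has a mean
  above 1/a, however small \<open>a\<close> is. The means of the finite sum tend to 0, so waiting
  long enough gives a time \<open>m'\<close> at which they are below \<epsilon>.\<close>

lemma sliding_hump_step:
  assumes growth: "\<And>i n. i \<in> I \<Longrightarrow> s i n \<le> K ^ n" and K: "1 \<le> K"
    and vanishing: "\<And>i. i \<in> I \<Longrightarrow> mean_upto (s i) \<longlonglongrightarrow> 0"
    and unbounded: "\<And>L. \<exists>i\<in>I. \<exists>N. L < mean_upto (s i) N"
    and F: "mean_upto F \<longlonglongrightarrow> 0" and \<epsilon>: "0 < \<epsilon>"
  obtains i a N m' where "i \<in> I" "0 < a" "a * K ^ m \<le> \<epsilon>" "m < N" "N \<le> m'"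
    "1 \<le> a * mean_upto (s i) N"
    "mean_upto (\<lambda>n. F n + a * s i n) m' \<le> \<epsilon>"
    "mean_upto (\<lambda>n. F n + a * s i n) \<longlonglongrightarrow> 0"
proof -
  define a where "a = \<epsilon> / K ^ m"
  have a: "0 < a" "a * K ^ m = \<epsilon>" using K \<epsilon> by (auto simp: a_def)
  \<comment> \<open>Exceeding 1/a makes the hump; exceeding \<open>K ^ m\<close> forces it to occur
    after \<open>m\<close>, because a mean up to \<open>N\<close> is at most
    \<open>K ^ N\<close>.\<close>
  obtain i N where i: "i \<in> I" and "max (1 / a) (K ^ m) < mean_upto (s i) N"
    using unbounded by blast
  then have N: "1 / a < mean_upto (s i) N" "K ^ m < mean_upto (s i) N" by auto
  have "0 < K ^ m" using K by simp
  then have "mean_upto (s i) N \<noteq> 0" using N by linarith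
  \<comment> \<open>Division by zero makes the mean at \<open>N = 0\<close> equal to 0.\<close>
  then have "0 < N" by (cases N) (auto simp: mean_upto_def)
  have "mean_upto (s i) N \<le> mean_upto (\<lambda>_. K ^ N) N"
  proof (rule mean_upto_mono)
    fix n assume "n \<in> {1..N}"
    then have "K ^ n \<le> K ^ N" using K by (intro power_increasing) auto
    then show "s i n \<le> K ^ N" using growth[OF i, of n] by linarith
  qed
  then have "K ^ m < K ^ N" using N \<open>0 < N\<close> by (simp add: mean_upto_const)
  then have "m < N" using K
    by (meson leD leI power_increasing)
  have "(\<lambda>N. mean_upto F N + a * mean_upto (s i) N) \<longlonglongrightarrow> 0 + a * 0"
    by (intro tendsto_intros F vanishing i)
  then have lim: "mean_upto (\<lambda>n. F n + a * s i n) \<longlonglongrightarrow> 0"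
    by (simp add: mean_upto_add mean_upto_cmult)
  have "eventually (\<lambda>m'. mean_upto (\<lambda>n. F n + a * s i n) m' < \<epsilon> \<and> N \<le> m') sequentially"
    by (intro eventually_conj order_tendstoD(2)[OF lim] \<epsilon> eventually_ge_at_top)
  then obtain m' where "mean_upto (\<lambda>n. F n + a * s i n) m' < \<epsilon>" "N \<le> m'"
    by (auto simp: eventually_sequentially)
  moreover have "1 \<le> a * mean_upto (s i) N"
    using N a by (simp add: field_simps)
  ultimately show ?thesis
    using that[of i a N m'] i a \<open>m < N\<close> lim by auto
qed

text \<open>The last conclusion concerns every \<open>r\<close> squeezed between the single terms
  and their sum, because it will be applied to an l^p norm of the sequence of terms. A lower bound
  by each term preserves the humps, and an upper bound by the sum preserves the small means between
  them.\<close>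

lemma sliding_hump:
  fixes s :: "'i \<Rightarrow> nat \<Rightarrow> real"
  assumes nonneg: "\<And>i n. i \<in> I \<Longrightarrow> 0 \<le> s i n"
    and growth: "\<And>i n. i \<in> I \<Longrightarrow> s i n \<le> K ^ n" and K: "1 \<le> K"
    and vanishing: "\<And>i. i \<in> I \<Longrightarrow> mean_upto (s i) \<longlonglongrightarrow> 0"
    and unbounded: "\<And>L. \<exists>i\<in>I. \<exists>N. L < mean_upto (s i) N"
  obtains i :: "nat \<Rightarrow> 'i" and a :: "nat \<Rightarrow> real"
  where "\<And>k. i k \<in> I" "\<And>k. 0 \<le> a k" "\<And>n. summable (\<lambda>k. a k * s (i k) n)" "summable a"
    "\<And>r. \<lbrakk>\<And>n k. a k * s (i k) n \<le> r n; \<And>n. r n \<le> (\<Sum>k. a k * s (i k) n)\<rbrakk> \<Longrightarrow>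
       liminf (\<lambda>N. ereal (mean_upto r N)) = 0 \<and> 1 \<le> limsup (\<lambda>N. ereal (mean_upto r N))"
proof -
  \<comment> \<open>A state of the recursion consists of the partial sum so far, the current time,
    and the index and coefficient of the term added last. The clause for \<open>k = 0\<close> in
    \<open>?P\<close> makes the empty initial sum recoverable from the chosen sequence; the other
    components of the initial state are arbitrary.\<close>
  let ?F = "\<lambda>x::(nat \<Rightarrow> real) \<times> nat \<times> 'i \<times> real. fst x" and ?m = "\<lambda>x. fst (snd x)"
    and ?i = "\<lambda>x. fst (snd (snd x))" and ?a = "\<lambda>x. snd (snd (snd x))"
  let ?P = "\<lambda>(k::nat) x. mean_upto (?F x) \<longlonglongrightarrow> 0 \<and> (k = 0 \<longrightarrow> ?F x = (\<lambda>_. 0))"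
  let ?Q = "\<lambda>(k::nat) x y. ?i y \<in> I \<and> 0 < ?a y \<and> ?a y * K ^ ?m x \<le> (1/2) ^ k \<and> ?m x < ?m y \<and>
     (\<exists>N>?m x. 1 \<le> ?a y * mean_upto (s (?i y)) N) \<and> mean_upto (?F y) (?m y) \<le> (1/2) ^ k \<and>
     ?F y = (\<lambda>n. ?F x n + ?a y * s (?i y) n)"
  have "\<exists>st. \<forall>k. ?P k (st k) \<and> ?Q k (st k) (st (Suc k))"
  proof (rule dependent_nat_choice)
    show "\<exists>x. ?P 0 x"
      by (rule exI[of _ "((\<lambda>_. 0), undefined)"]) (simp add: mean_upto_zero)
  next
    fix x :: "(nat \<Rightarrow> real) \<times> nat \<times> 'i \<times> real" and k
    assume P: "?P k x"
    then have F: "mean_upto (?F x) \<longlonglongrightarrow> 0" by blast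
    show "\<exists>y. ?P (Suc k) y \<and> ?Q k x y"
    proof (rule sliding_hump_step[OF growth K vanishing unbounded F, of "(1/2) ^ k" "?m x"])
      fix i' a' N m'
      assume "i' \<in> I" "0 < a'" "a' * K ^ ?m x \<le> (1/2) ^ k" "?m x < N" "N \<le> m'"
        "1 \<le> a' * mean_upto (s i') N"
        "mean_upto (\<lambda>n. ?F x n + a' * s i' n) m' \<le> (1/2) ^ k"
        "mean_upto (\<lambda>n. ?F x n + a' * s i' n) \<longlonglongrightarrow> 0"
      then show ?thesis
        by (intro exI[of _ "(\<lambda>n. ?F x n + a' * s i' n, m', i', a')"]) auto
    qed auto
  qed
  then obtain st where st: "\<And>k. ?P k (st k)" "\<And>k. ?Q k (st k) (st (Suc k))" by blast
  \<comment> \<open>Partial sum and time are read off state \<open>k\<close>, but index and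
    coefficient off state \<open>Suc k\<close>: thus \<open>F k\<close> contains exactly the terms
    with number below \<open>k\<close>, and hump \<open>k\<close> lies after
    \<open>m k\<close>.\<close>
  define F m i a where "F k = fst (st k)" and "m k = fst (snd (st k))"
    and "i k = fst (snd (snd (st (Suc k))))" and "a k = snd (snd (snd (st (Suc k))))" for k
  have i: "i k \<in> I" and a: "0 < a k" and aK: "a k * K ^ m k \<le> (1/2) ^ k"
    and m: "m k < m (Suc k)" and hump: "\<exists>N>m k. 1 \<le> a k * mean_upto (s (i k)) N"
    and small: "mean_upto (F (Suc k)) (m (Suc k)) \<le> (1/2) ^ k"
    and F_Suc: "F (Suc k) = (\<lambda>n. F k n + a k * s (i k) n)" for k
    using st(2)[of k] unfolding F_def m_def i_def a_def by blast+
  have F_0: "F 0 = (\<lambda>_. 0)"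
    using st(1)[of 0] by (simp add: F_def)
  have F_eq: "F k n = (\<Sum>j<k. a j * s (i j) n)" for k n
    by (induction k) (auto simp: F_0 F_Suc)
  have m_mono: "strict_mono m" using m by (simp add: strict_mono_Suc_iff)
  have geometric: "summable (\<lambda>k. (1/2::real) ^ k)" by (simp add: summable_geometric)
  \<comment> \<open>Up to time \<open>m j\<close>, before its own hump, the term \<open>j\<close> is
    negligible.\<close>
  have term_le: "a j * s (i j) n \<le> (1/2) ^ j" if "n \<le> m j" for j n
  proof -
    have "a j * s (i j) n \<le> a j * K ^ n"
      using growth[OF i] a[of j] by (intro mult_left_mono) auto
    also have "\<dots> \<le> a j * K ^ m j"
      using K that a[of j] by (intro mult_left_mono power_increasing) auto
    finally show ?thesis using aK[of j] by linarith
  qed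
  have term_nonneg: "0 \<le> a j * s (i j) n" for j n
    using a[of j] nonneg[OF i, of j n] by simp
  have summ: "summable (\<lambda>k. a k * s (i k) n)" for n
  proof (rule summable_comparison_test_ev[OF _ geometric])
    \<comment> \<open>A strictly increasing \<open>m\<close> satisfies \<open>k \<le> m k\<close>,
      so at a fixed time \<open>n\<close> all terms from number \<open>n\<close> on are
      negligible.\<close>
    have "norm (a k * s (i k) n) \<le> (1/2) ^ k" if "n \<le> k" for k
      using term_le[of n k] that seq_suble[OF m_mono, of k] term_nonneg[of k n]
      by (metis abs_of_nonneg order.trans real_norm_def)
    then show "\<forall>\<^sub>F k in sequentially. norm (a k * s (i k) n) \<le> (1/2) ^ k"
      by (auto simp: eventually_sequentially)
  qed
  have a_le: "a k \<le> (1/2) ^ k" for k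
  proof -
    have "a k * 1 \<le> a k * K ^ m k" using a[of k] K by (intro mult_left_mono) auto
    then show ?thesis using aK[of k] by simp
  qed
  have "summable a"
    by (rule summable_comparison_test[OF _ geometric])
       (use a a_le in \<open>auto simp: less_imp_le intro!: exI[of _ 0]\<close>)
  have tail: "(\<Sum>j. a j * s (i j) n) \<le> F k n + 2 * (1/2) ^ k" if "n \<le> m k" for n k
  proof -
    have "(\<Sum>j. a (j + k) * s (i (j + k)) n) \<le> (\<Sum>j. (1/2) ^ (j + k))"
    proof (rule suminf_le)
      show "a (j + k) * s (i (j + k)) n \<le> (1/2) ^ (j + k)" for j
        using that strict_mono_leD[OF m_mono, of k "j + k"] by (intro term_le) auto
      show "summable (\<lambda>j. a (j + k) * s (i (j + k)) n)"
        using summable_ignore_initial_segment[OF summ] .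
      show "summable (\<lambda>j. (1/2::real) ^ (j + k))"
        using summable_ignore_initial_segment[OF geometric] .
    qed
    also have "\<dots> = 2 * (1/2) ^ k"
      using suminf_mult2[OF geometric, of "(1/2) ^ k"] suminf_geometric[of "1/2 :: real"]
      by (simp add: power_add)
    finally show ?thesis
      using suminf_split_initial_segment[OF summ, of n k] by (simp add: F_eq)
  qed
  show ?thesis
  proof (rule that[of i a])
    fix r
    assume lower: "\<And>n k. a k * s (i k) n \<le> r n"
      and upper: "\<And>n. r n \<le> (\<Sum>k. a k * s (i k) n)"
    have mean_nonneg: "0 \<le> mean_upto r N" for N
      by (rule mean_upto_nonneg) (use lower term_nonneg order.trans in blast)
    have "liminf (\<lambda>N. ereal (mean_upto r N)) = 0"
    proof (rule liminf_zero_if_small[OF mean_nonneg, of "m \<circ> Suc"])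
      show "strict_mono (m \<circ> Suc)" using m_mono by (simp add: strict_mono_def)
      \<comment> \<open>At time \<open>m (Suc k)\<close> the terms up to \<open>k\<close> have mean
        at most 2^(-k) by the choice of that time, and the later terms add at most 2 *
        2^(-(k+1)).\<close>
      have bound: "mean_upto r (m (Suc k)) \<le> 2 * (1/2) ^ k" for k
      proof -
        have "mean_upto r (m (Suc k)) \<le> mean_upto (\<lambda>n. F (Suc k) n + 2 * (1/2) ^ Suc k) (m (Suc k))"
          by (rule mean_upto_mono) (use upper tail order.trans in \<open>meson atLeastAtMost_iff\<close>)
        also have "\<dots> = mean_upto (F (Suc k)) (m (Suc k)) + 2 * (1/2) ^ Suc k"
          using m[of k] by (simp only: mean_upto_add mean_upto_const)
        finally show ?thesis using small[of k] by simp
      qed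
      have "(\<lambda>k. 2 * (1/2::real) ^ k) \<longlonglongrightarrow> 2 * 0"
        by (intro tendsto_mult tendsto_const LIMSEQ_power_zero) simp
      then have "(\<lambda>k. 2 * (1/2::real) ^ k) \<longlonglongrightarrow> 0" by simp
      then show "(\<lambda>k. mean_upto r ((m \<circ> Suc) k)) \<longlonglongrightarrow> 0"
        by (rule tendsto_sandwich[OF _ _ tendsto_const, rotated 2])
           (simp_all only: o_def mean_nonneg bound eventually_True)
    qed
    moreover have "ereal 1 \<le> limsup (\<lambda>N. ereal (mean_upto r N))"
    proof (rule limsup_ge_if_frequently)
      fix l
      obtain N where N: "N > m l" "1 \<le> a l * mean_upto (s (i l)) N" using hump by blast
      have "a l * mean_upto (s (i l)) N \<le> mean_upto r N"
        using mean_upto_mono[of N "\<lambda>n. a l * s (i l) n" r] lower by (simp add: mean_upto_cmult)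
      then show "\<exists>N>l. 1 \<le> mean_upto r N"
        using N seq_suble[OF m_mono, of l] by (intro exI[of _ N]) auto
    qed
    ultimately show "liminf (\<lambda>N. ereal (mean_upto r N)) = 0 \<and> 1 \<le> limsup (\<lambda>N. ereal (mean_upto r N))"
      unfolding one_ereal_def by (rule conjI)
  qed (use i a summ \<open>summable a\<close> in \<open>auto simp: less_imp_le\<close>)
qed

text \<open>The l^p norm is at most the l^1 norm: each entry is at most the sum \<open>V\<close>,
  hence v^p = v * v^(p-1) is at most v * V^(p-1), and these bounds sum to V^p.\<close>

lemma summable_powr_ge_1:
  fixes v :: "nat \<Rightarrow> real"
  assumes "summable v" and "\<And>k. 0 \<le> v k" and "1 \<le> p"
  shows "summable (\<lambda>k. v k powr p)" and "(\<Sum>k. v k powr p) \<le> (\<Sum>k. v k) powr p"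
proof -
  define V where "V = (\<Sum>k. v k)"
  have split: "x powr p = x * x powr (p - 1)" if "0 \<le> x" for x :: real
    using that powr_add[of x 1 "p - 1"] by (cases "x = 0") auto
  have le: "v k powr p \<le> v k * V powr (p - 1)" for k
    using sum_le_suminf[OF assms(1), of "{k}"] assms unfolding split[OF assms(2)]
    by (intro mult_left_mono powr_mono2) (auto simp: V_def)
  have rhs: "summable (\<lambda>k. v k * V powr (p - 1))"
    using assms(1) by (rule summable_mult2)
  show summ: "summable (\<lambda>k. v k powr p)"
    by (rule summable_comparison_test[OF _ rhs]) (use le in auto)
  have "0 \<le> V" unfolding V_def by (intro suminf_nonneg assms)
  have "(\<Sum>k. v k powr p) \<le> (\<Sum>k. v k * V powr (p - 1))"
    by (rule suminf_le[OF le summ rhs])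
  also have "\<dots> = V powr p"
    using suminf_mult2[OF assms(1), of "V powr (p - 1)"] split[OF \<open>0 \<le> V\<close>] by (simp add: V_def)
  finally show "(\<Sum>k. v k powr p) \<le> (\<Sum>k. v k) powr p" by (simp add: V_def)
qed


section \<open>Push-forwards of the weighted measures and the growth of the iterates\<close>

context weighted_composition
begin

declare w_measurable [measurable]

lemma f_meas [measurable]: "f \<in> M \<rightarrow>\<^sub>M M"
  using f_bimeasurable by (simp add: bimeasurable_def)

lemma funpow_meas [measurable]: "f ^^ n \<in> M \<rightarrow>\<^sub>M M"
  by (induction n) (auto intro: measurable_comp)

lemma weight_iterate_meas [measurable]: "weight_iterate w f n \<in> borel_measurable M"
  unfolding weight_iterate_def by measurable

lemma weight_iterate_Suc: "weight_iterate w f (Suc n) x = w x * weight_iterate w f n (f x)"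
  unfolding weight_iterate_def by (subst prod.lessThan_Suc_shift) (simp add: funpow_swap1)

text \<open>Applied to a preimage, the bound in the locale says that the image under
  \<open>f\<close> of the measure with density |w|^p is dominated by c \<mu>, because f maps the
  preimage of B into B. Domination of measures passes to integrals.\<close>

lemma nn_integral_weight_le:
  obtains c :: real where "0 < c"
    "\<And>g. g \<in> borel_measurable M \<Longrightarrow>
       (\<integral>\<^sup>+x. ennreal (norm (w x) powr p) * g (f x) \<partial>M) \<le> ennreal c * (\<integral>\<^sup>+x. g x \<partial>M)"
proof -
  obtain c :: real where c: "0 < c" and *: "\<And>B. B \<in> sets M \<Longrightarrow>
      (\<integral>\<^sup>+x\<in>B. ennreal (norm (w x) powr p) \<partial>M) \<le> ennreal c * emeasure M (f ` B)"
    using bounded by blast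
  define D where "D = density M (\<lambda>x. ennreal (norm (w x) powr p))"
  have D: "distr D M f \<le> scale_measure (ennreal c) M"
  proof (subst le_measure, simp, intro ballI)
    fix B assume "B \<in> sets (distr D M f)"
    then have B: "B \<in> sets M" by simp
    then have pre: "f -` B \<inter> space M \<in> sets M" by (rule measurable_sets[OF f_meas])
    have "emeasure (distr D M f) B = (\<integral>\<^sup>+x\<in>f -` B \<inter> space M. ennreal (norm (w x) powr p) \<partial>M)"
      using B pre by (subst emeasure_distr) (auto simp: D_def emeasure_density)
    also have "\<dots> \<le> ennreal c * emeasure M (f ` (f -` B \<inter> space M))"
      by (rule *[OF pre])
    also have "\<dots> \<le> ennreal c * emeasure M B"
      using B by (intro mult_left_mono emeasure_mono) auto
    finally show "emeasure (distr D M f) B \<le> emeasure (scale_measure (ennreal c) M) B" by simp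
  qed
  have "(\<integral>\<^sup>+x. ennreal (norm (w x) powr p) * g (f x) \<partial>M) \<le> ennreal c * (\<integral>\<^sup>+x. g x \<partial>M)"
    if g [measurable]: "g \<in> borel_measurable M" for g
  proof -
    have "(\<integral>\<^sup>+x. ennreal (norm (w x) powr p) * g (f x) \<partial>M) = (\<integral>\<^sup>+x. g x \<partial>distr D M f)"
      by (simp add: D_def nn_integral_distr nn_integral_density)
    also have "\<dots> \<le> (\<integral>\<^sup>+x. g x \<partial>scale_measure (ennreal c) M)"
      by (rule nn_integral_mono_measure[OF _ D]) simp
    finally show ?thesis by (simp add: nn_integral_scale_measure)
  qed
  then show ?thesis using that c by blast
qed

lemma nn_integral_weight_iterate_le:
  obtains K :: real where "1 \<le> K"
    "\<And>g n. g \<in> borel_measurable M \<Longrightarrow>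
       (\<integral>\<^sup>+x. ennreal (norm (weight_iterate w f n x) powr p) * g ((f ^^ n) x) \<partial>M)
         \<le> ennreal (K ^ n) * (\<integral>\<^sup>+x. g x \<partial>M)"
proof -
  obtain c :: real where c: "0 < c" and *: "\<And>g. g \<in> borel_measurable M \<Longrightarrow>
       (\<integral>\<^sup>+x. ennreal (norm (w x) powr p) * g (f x) \<partial>M) \<le> ennreal c * (\<integral>\<^sup>+x. g x \<partial>M)"
    using nn_integral_weight_le by blast
  \<comment> \<open>The maximum with 1 makes the bounds increasing in \<open>n\<close>, as the
    sliding hump requires.\<close>
  have "(\<integral>\<^sup>+x. ennreal (norm (weight_iterate w f n x) powr p) * g ((f ^^ n) x) \<partial>M)
         \<le> ennreal (max 1 c ^ n) * (\<integral>\<^sup>+x. g x \<partial>M)"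
    if g [measurable]: "g \<in> borel_measurable M" for g n
  proof (induction n)
    case 0
    then show ?case by (simp add: weight_iterate_def)
  next
    case (Suc n)
    let ?h = "\<lambda>x. ennreal (norm (weight_iterate w f n x) powr p) * g ((f ^^ n) x)"
    have "(\<integral>\<^sup>+x. ennreal (norm (weight_iterate w f (Suc n) x) powr p) * g ((f ^^ Suc n) x) \<partial>M)
        = (\<integral>\<^sup>+x. ennreal (norm (w x) powr p) * ?h (f x) \<partial>M)"
      by (intro nn_integral_cong)
         (simp add: weight_iterate_Suc norm_mult powr_mult ennreal_mult' funpow_swap1 mult.assoc)
    also have "\<dots> \<le> ennreal c * (\<integral>\<^sup>+x. ?h x \<partial>M)" by (rule *) measurable
    also have "\<dots> \<le> ennreal (max 1 c) * (ennreal (max 1 c ^ n) * (\<integral>\<^sup>+x. g x \<partial>M))"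
      by (intro mult_mono Suc ennreal_leI) auto
    also have "\<dots> = ennreal (max 1 c ^ Suc n) * (\<integral>\<^sup>+x. g x \<partial>M)"
      by (simp add: ennreal_mult' mult.assoc)
    finally show ?case .
  qed
  then show ?thesis using that[of "max 1 c"] by simp
qed

text \<open>The p-th power of the norm of the \<open>n\<close>-th iterate at \<phi> is the integral
  of |\<phi>|^p against this measure, hence additive in |\<phi>|^p.\<close>

definition pushforward :: "nat \<Rightarrow> 'a measure" where
  "pushforward n = distr (weighted_measure p M w f n) M (f ^^ n)"

lemma sets_pushforward [simp, measurable_cong]: "sets (pushforward n) = sets M"
  by (simp add: pushforward_def)

lemma nn_integral_pushforward:
  assumes [measurable]: "g \<in> borel_measurable M"
  shows "(\<integral>\<^sup>+x. g x \<partial>pushforward n)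
    = (\<integral>\<^sup>+x. ennreal (norm (weight_iterate w f n x) powr p) * g ((f ^^ n) x) \<partial>M)"
proof -
  have "f ^^ n \<in> weighted_measure p M w f n \<rightarrow>\<^sub>M M"
    unfolding weighted_measure_def by measurable
  then have "(\<integral>\<^sup>+x. g x \<partial>pushforward n) = (\<integral>\<^sup>+x. g ((f ^^ n) x) \<partial>weighted_measure p M w f n)"
    unfolding pushforward_def by (rule nn_integral_distr) measurable
  also have "\<dots> = (\<integral>\<^sup>+x. ennreal (norm (weight_iterate w f n x) powr p) * g ((f ^^ n) x) \<partial>M)"
    unfolding weighted_measure_def by (rule nn_integral_density) measurable
  finally show ?thesis .
qed

lemma nn_integral_pushforward_le:
  "\<exists>K\<ge>1. \<forall>n. \<forall>g\<in>borel_measurable M.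
     (\<integral>\<^sup>+x. g x \<partial>pushforward n) \<le> ennreal (K ^ n) * (\<integral>\<^sup>+x. g x \<partial>M)"
proof (rule nn_integral_weight_iterate_le)
  fix K :: real
  assume "1 \<le> K" and K: "\<And>g n. g \<in> borel_measurable M \<Longrightarrow>
       (\<integral>\<^sup>+x. ennreal (norm (weight_iterate w f n x) powr p) * g ((f ^^ n) x) \<partial>M)
         \<le> ennreal (K ^ n) * (\<integral>\<^sup>+x. g x \<partial>M)"
  then show ?thesis
    by (intro exI[of _ K] conjI allI ballI) (simp_all only: nn_integral_pushforward)
qed

lemma absolutely_continuous_pushforward: "absolutely_continuous M (pushforward n)"
  unfolding absolutely_continuous_def
proof
  fix N assume N: "N \<in> null_sets M"
  obtain K where K: "\<And>g n. g \<in> borel_measurable M \<Longrightarrow>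
       (\<integral>\<^sup>+x. g x \<partial>pushforward n) \<le> ennreal (K ^ n) * (\<integral>\<^sup>+x. g x \<partial>M)"
    using nn_integral_pushforward_le by blast
  show "N \<in> null_sets (pushforward n)"
    using N K[of "indicator N" n, OF borel_measurable_indicator] by (auto simp: null_sets_def)
qed

lemma preimage_size_eq:
  assumes "B \<in> sets M"
  shows "preimage_size p M w f n B = measure (pushforward n) B powr (1 / p)"
proof -
  have "f ^^ n \<in> weighted_measure p M w f n \<rightarrow>\<^sub>M M"
    unfolding weighted_measure_def by measurable
  then have "measure (pushforward n) B
      = measure (weighted_measure p M w f n) ((f ^^ n) -` B \<inter> space (weighted_measure p M w f n))"
    unfolding pushforward_def by (rule measure_distr) (rule assms)
  then show ?thesis by (simp add: preimage_size_def weighted_measure_def)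
qed

section \<open>Iterates of the operator on representatives and on classes\<close>

definition orbit :: "nat \<Rightarrow> ('a \<Rightarrow> 'k) \<Rightarrow> 'a \<Rightarrow> 'k" where
  "orbit n \<phi> x = weight_iterate w f n x * \<phi> ((f ^^ n) x)"

lemma orbit_meas:
  assumes [measurable]: "\<phi> \<in> borel_measurable M"
  shows "orbit n \<phi> \<in> borel_measurable M"
proof -
  have "(\<lambda>x. weight_iterate w f n x * \<phi> ((f ^^ n) x)) \<in> borel_measurable M" by measurable
  then show ?thesis by (simp only: orbit_def[abs_def])
qed

lemma Lp_functions_iff:
  "\<phi> \<in> Lp_functions p M \<longleftrightarrow>
     \<phi> \<in> borel_measurable M \<and> (\<integral>\<^sup>+x. ennreal (norm (\<phi> x) powr p) \<partial>M) < \<infinity>"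
  for \<phi> :: "'a \<Rightarrow> 'k"
  unfolding Lp_functions_def by (auto simp: integrable_iff_bounded)

lemma Lp_norm_eq:
  fixes \<phi> :: "'a \<Rightarrow> 'k"
  assumes "\<phi> \<in> borel_measurable M"
  shows "Lp_norm p M \<phi> = enn2real (\<integral>\<^sup>+x. ennreal (norm (\<phi> x) powr p) \<partial>M) powr (1 / p)"
  unfolding Lp_norm_def using assms by (subst integral_eq_nn_integral) auto

lemma nn_integral_orbit:
  assumes [measurable]: "\<phi> \<in> borel_measurable M"
  shows "(\<integral>\<^sup>+x. ennreal (norm (orbit n \<phi> x) powr p) \<partial>M) = (\<integral>\<^sup>+x. ennreal (norm (\<phi> x) powr p) \<partial>pushforward n)"
proof -
  have "ennreal (norm (orbit n \<phi> x) powr p)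
      = ennreal (norm (weight_iterate w f n x) powr p) * ennreal (norm (\<phi> ((f ^^ n) x)) powr p)" for x
    by (simp only: orbit_def norm_mult powr_mult ennreal_mult' powr_ge_zero)
  moreover have "(\<lambda>x. ennreal (norm (\<phi> x) powr p)) \<in> borel_measurable M" by measurable
  ultimately show ?thesis by (simp only: nn_integral_pushforward)
qed

lemma orbit_in_Lp:
  assumes "\<phi> \<in> Lp_functions p M"
  shows "orbit n \<phi> \<in> Lp_functions p M"
proof -
  have [measurable]: "\<phi> \<in> borel_measurable M" using assms by (simp add: Lp_functions_iff)
  obtain K where K: "\<And>g n. g \<in> borel_measurable M \<Longrightarrow>
       (\<integral>\<^sup>+x. g x \<partial>pushforward n) \<le> ennreal (K ^ n) * (\<integral>\<^sup>+x. g x \<partial>M)"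
    using nn_integral_pushforward_le by blast
  have "(\<integral>\<^sup>+x. ennreal (norm (orbit n \<phi> x) powr p) \<partial>M)
      \<le> ennreal (K ^ n) * (\<integral>\<^sup>+x. ennreal (norm (\<phi> x) powr p) \<partial>M)"
    unfolding nn_integral_orbit[OF \<open>\<phi> \<in> borel_measurable M\<close>] by (rule K) measurable
  also have "\<dots> < \<infinity>"
    using assms by (auto simp: Lp_functions_iff ennreal_mult_less_top)
  finally show ?thesis
    using orbit_meas[OF \<open>\<phi> \<in> borel_measurable M\<close>, of n] unfolding Lp_functions_iff by blast
qed

text \<open>The preimage of a null set under \<open>f ^^ n\<close> may have positive measure, but
  then the weight vanishes a.e. on it. The push-forward takes care of this: it ignores the null set,
  so the orbit of the difference has norm zero.\<close>

lemma orbit_cong_AE: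
  assumes [measurable]: "\<phi> \<in> borel_measurable M" "\<psi> \<in> borel_measurable M"
    and eq: "AE x in M. \<phi> x = \<psi> x"
  shows "AE x in M. orbit n \<phi> x = orbit n \<psi> x"
proof -
  let ?\<delta> = "\<lambda>x. \<phi> x - \<psi> x"
  have [measurable]: "orbit n ?\<delta> \<in> borel_measurable M" by (rule orbit_meas) measurable
  have "AE x in pushforward n. \<phi> x = \<psi> x"
    by (rule absolutely_continuous_AE[OF _ absolutely_continuous_pushforward eq]) simp
  then have "(\<integral>\<^sup>+x. ennreal (norm (?\<delta> x) powr p) \<partial>pushforward n) = 0"
    by (subst nn_integral_0_iff_AE) auto
  then have "(\<integral>\<^sup>+x. ennreal (norm (orbit n ?\<delta> x) powr p) \<partial>M) = 0"
    by (simp add: nn_integral_orbit)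
  then have "AE x in M. orbit n ?\<delta> x = 0"
    by (subst (asm) nn_integral_0_iff_AE) (auto simp: powr_eq_0_iff)
  then show ?thesis by (auto simp: orbit_def)
qed

lemma orbit_Suc: "orbit n \<phi> (f x) * w x = orbit (Suc n) \<phi> x"
  by (simp add: orbit_def weight_iterate_Suc funpow_swap1)

lemma wc_op_class:
  assumes \<phi>: "\<phi> \<in> Lp_functions p M"
  shows "wc_op p M w f (Lp_rel p M `` {\<phi>}) = Lp_rel p M `` {orbit 1 \<phi>}"
proof -
  have one: "(\<lambda>x. \<psi> (f x) * w x) = orbit 1 \<psi>" for \<psi> :: "'a \<Rightarrow> 'k"
    using orbit_Suc[of 0 \<psi>] by (auto simp: fun_eq_iff orbit_def weight_iterate_def)
  have "Lp_rel p M `` {orbit 1 \<psi>} = Lp_rel p M `` {orbit 1 \<phi>}" if "\<psi> \<in> Lp_rel p M `` {\<phi>}" for \<psi>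
  proof -
    have \<psi>: "\<psi> \<in> Lp_functions p M" and "AE x in M. \<phi> x = \<psi> x"
      using that by (auto simp: Lp_rel_def)
    then have eq: "AE x in M. orbit 1 \<phi> x = orbit 1 \<psi> x"
      using \<phi> by (intro orbit_cong_AE) (auto simp: Lp_functions_iff)
    have "(AE x in M. orbit 1 \<phi> x = g x) \<longleftrightarrow> (AE x in M. orbit 1 \<psi> x = g x)" for g
    proof
      assume "AE x in M. orbit 1 \<phi> x = g x"
      with eq show "AE x in M. orbit 1 \<psi> x = g x" by eventually_elim simp
    next
      assume "AE x in M. orbit 1 \<psi> x = g x"
      with eq show "AE x in M. orbit 1 \<phi> x = g x" by eventually_elim simp
    qed
    then show ?thesis
      using orbit_in_Lp[OF \<phi>] orbit_in_Lp[OF \<psi>] by (auto simp: Lp_rel_def)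
  qed
  \<comment> \<open>All sets in the union defining \<open>wc_op\<close> coincide; the union equals
    that common class because it runs over a nonempty set.\<close>
  moreover have "\<phi> \<in> Lp_rel p M `` {\<phi>}" using \<phi> by (auto simp: Lp_rel_def)
  ultimately show ?thesis unfolding wc_op_def one by blast
qed

text \<open>Together with \<open>Lp_dist_class\<close> this reduces the dynamics on classes to norms
  of \<open>orbit n \<phi>\<close> for one representative.\<close>

lemma wc_op_funpow_class:
  assumes \<phi>: "\<phi> \<in> Lp_functions p M"
  shows "(wc_op p M w f ^^ n) (Lp_rel p M `` {\<phi>}) = Lp_rel p M `` {orbit n \<phi>}"
proof (induction n)
  case 0
  then show ?case by (simp add: orbit_def weight_iterate_def)
next
  case (Suc n)
  have "orbit 1 (orbit n \<phi>) = orbit (Suc n) \<phi>"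
    by (simp add: fun_eq_iff orbit_Suc[symmetric]) (simp add: orbit_def weight_iterate_def mult_ac)
  then show ?case using Suc wc_op_class[OF orbit_in_Lp[OF \<phi>]] by simp
qed

lemma Lp_dist_class:
  fixes \<phi> \<psi> :: "'a \<Rightarrow> 'k"
  assumes \<phi>: "\<phi> \<in> Lp_functions p M" and \<psi>: "\<psi> \<in> Lp_functions p M"
  shows "Lp_dist p M (Lp_rel p M `` {\<phi>}) (Lp_rel p M `` {\<psi>}) = Lp_norm p M (\<lambda>x. \<phi> x - \<psi> x)"
proof -
  have rep: "(SOME \<eta>. \<eta> \<in> Lp_rel p M `` {\<phi>}) \<in> Lp_rel p M `` {\<phi>}"
    if "\<phi> \<in> Lp_functions p M" for \<phi> :: "'a \<Rightarrow> 'k"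
    by (rule someI[of _ \<phi>]) (use that in \<open>auto simp: Lp_rel_def\<close>)
  define \<phi>' where "\<phi>' = (SOME \<eta>. \<eta> \<in> Lp_rel p M `` {\<phi>})"
  define \<psi>' where "\<psi>' = (SOME \<eta>. \<eta> \<in> Lp_rel p M `` {\<psi>})"
  have "\<phi>' \<in> Lp_rel p M `` {\<phi>}" "\<psi>' \<in> Lp_rel p M `` {\<psi>}"
    unfolding \<phi>'_def \<psi>'_def using rep \<phi> \<psi> by blast+
  then have [measurable]: "\<phi>' \<in> borel_measurable M" "\<psi>' \<in> borel_measurable M"
    "\<phi> \<in> borel_measurable M" "\<psi> \<in> borel_measurable M"
    and AE: "AE x in M. \<phi> x = \<phi>' x" "AE x in M. \<psi> x = \<psi>' x"
    by (simp_all add: Lp_rel_def Lp_functions_iff)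
  from AE have "AE x in M. norm (\<phi>' x - \<psi>' x) powr p = norm (\<phi> x - \<psi> x) powr p"
    by eventually_elim simp
  then have "(\<integral>x. norm (\<phi>' x - \<psi>' x) powr p \<partial>M) = (\<integral>x. norm (\<phi> x - \<psi> x) powr p \<partial>M)"
    by (rule integral_cong_AE[rotated 2]) measurable
  then show ?thesis by (simp add: Lp_dist_def Lp_norm_def \<phi>'_def \<psi>'_def)
qed

section \<open>Chaos from the real line spanned by one vector\<close>

lemma Lp_norm_scaleR: "Lp_norm p M (\<lambda>x. t *\<^sub>R \<phi> x) = \<bar>t\<bar> * Lp_norm p M \<phi>"
  for \<phi> :: "'a \<Rightarrow> 'k"
proof -
  have "(\<integral>x. norm (t *\<^sub>R \<phi> x) powr p \<partial>M) = \<bar>t\<bar> powr p * (\<integral>x. norm (\<phi> x) powr p \<partial>M)"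
    by (simp add: powr_mult)
  then show ?thesis using p_ge_1 by (simp add: Lp_norm_def powr_mult powr_powr)
qed

lemma scaleR_in_Lp:
  fixes \<phi> :: "'a \<Rightarrow> 'k"
  assumes "\<phi> \<in> Lp_functions p M"
  shows "(\<lambda>x. t *\<^sub>R \<phi> x) \<in> Lp_functions p M"
  using assms by (auto simp: Lp_functions_def powr_mult)

lemma mean_Li_Yorke_chaotic_if_semi_irregular:
  assumes \<phi>: "\<phi> \<in> Lp_functions p M"
    and "liminf (\<lambda>N. ereal (mean_upto (\<lambda>n. Lp_norm p M (orbit n \<phi>)) N)) = 0"
    and "limsup (\<lambda>N. ereal (mean_upto (\<lambda>n. Lp_norm p M (orbit n \<phi>)) N)) > 0"
  shows "mean_Li_Yorke_chaotic (Lp_space p M) (Lp_dist p M) (wc_op p M w f)"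
proof -
  let ?T = "wc_op p M w f" and ?d = "Lp_dist p M"
  let ?r = "\<lambda>n. Lp_norm p M (orbit n \<phi>)"
  define V where "V t = Lp_rel p M `` {\<lambda>x. t *\<^sub>R \<phi> x}" for t :: real
  \<comment> \<open>By linearity all mean distances along a pair are |t-s| times the means of
    \<phi>, so both conditions on the pair follow from those on \<phi>.\<close>
  have dist: "?d ((?T ^^ n) (V t)) ((?T ^^ n) (V s)) = \<bar>t - s\<bar> * ?r n" for t s n
  proof -
    have "?d ((?T ^^ n) (V t)) ((?T ^^ n) (V s))
        = Lp_norm p M (\<lambda>x. orbit n (\<lambda>x. t *\<^sub>R \<phi> x) x - orbit n (\<lambda>x. s *\<^sub>R \<phi> x) x)"
      unfolding V_def
      by (simp only: wc_op_funpow_class[OF scaleR_in_Lp[OF \<phi>]]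
           Lp_dist_class[OF orbit_in_Lp[OF scaleR_in_Lp[OF \<phi>]] orbit_in_Lp[OF scaleR_in_Lp[OF \<phi>]]])
    also have "(\<lambda>x. orbit n (\<lambda>x. t *\<^sub>R \<phi> x) x - orbit n (\<lambda>x. s *\<^sub>R \<phi> x) x) = (\<lambda>x. (t - s) *\<^sub>R orbit n \<phi> x)"
      by (simp add: orbit_def fun_eq_iff scaleR_diff_left)
    finally show ?thesis by (simp only: Lp_norm_scaleR)
  qed
  \<comment> \<open>A positive limsup excludes that all norms vanish; one nonzero norm separates the
    classes of different multiples of \<phi>.\<close>
  obtain n where n: "?r n \<noteq> 0"
  proof (rule ccontr)
    assume "\<not> thesis"
    then have "?r n = 0" for n using that by blast
    then show False using assms(3) by (simp add: mean_upto_def zero_ereal_def[symmetric] Limsup_const)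
  qed
  have "inj V"
  proof (rule injI)
    fix t s assume "V t = V s"
    then have "\<bar>t - s\<bar> * ?r n = \<bar>t - t\<bar> * ?r n" using dist[of n t s] dist[of n t t] by simp
    then show "t = s" using n by simp
  qed
  have unc: "uncountable (range V)"
    using \<open>inj V\<close> uncountable_UNIV_real by (simp add: countable_image_inj_eq)
  have sub: "range V \<subseteq> Lp_space p M"
    unfolding Lp_space_def V_def by (auto intro!: quotientI scaleR_in_Lp \<phi>)
  have mean: "(\<Sum>n=1..N. ?d ((?T ^^ n) (V t)) ((?T ^^ n) (V s))) / real N = \<bar>t - s\<bar> * mean_upto ?r N" for t s N
    by (simp add: dist mean_upto_def sum_distrib_left)
  show ?thesis
    unfolding mean_Li_Yorke_chaotic_def
  proof (intro exI[of _ "range V"] conjI sub unc ballI impI)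
    fix x y assume "x \<in> range V" "y \<in> range V" "x \<noteq> y"
    then obtain t s where ts: "x = V t" "y = V s" "t \<noteq> s" by auto
    have pos: "ereal \<bar>t - s\<bar> > 0" "ereal \<bar>t - s\<bar> \<noteq> \<infinity>" using ts by auto
    have eq: "(\<lambda>N. ereal ((\<Sum>n=1..N. ?d ((?T ^^ n) x) ((?T ^^ n) y)) / real N))
        = (\<lambda>N. ereal \<bar>t - s\<bar> * ereal (mean_upto ?r N))"
      by (simp only: ts mean times_ereal.simps)
    show "liminf (\<lambda>N. ereal ((\<Sum>n=1..N. ?d ((?T ^^ n) x) ((?T ^^ n) y)) / real N)) = 0"
      unfolding eq using pos assms(2)
      by (subst Liminf_ereal_mult_left) auto
    show "0 < limsup (\<lambda>N. ereal ((\<Sum>n=1..N. ?d ((?T ^^ n) x) ((?T ^^ n) y)) / real N))"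
      unfolding eq using pos assms(3)
      by (subst Limsup_ereal_mult_left) (auto simp: ereal_zero_less_0_iff)
  qed
qed

section \<open>Vectors prescribed by the p-th power of their modulus, and superpositions\<close>

lemma powr_root_orbit:
  assumes [measurable]: "g \<in> borel_measurable M" and fin: "(\<integral>\<^sup>+x. g x \<partial>M) < \<infinity>"
  defines "\<phi> \<equiv> (\<lambda>x. of_real (enn2real (g x) powr (1 / p)) :: 'k)"
  shows "\<phi> \<in> Lp_functions p M"
    and "Lp_norm p M (orbit n \<phi>) = enn2real (\<integral>\<^sup>+x. g x \<partial>pushforward n) powr (1 / p)"
proof -
  have meas [measurable]: "\<phi> \<in> borel_measurable M" unfolding \<phi>_def by measurable
  have orbit [measurable]: "orbit n \<phi> \<in> borel_measurable M" by (rule orbit_meas) measurable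
  have norm: "norm (\<phi> x) powr p = enn2real (g x)" for x
    using p_ge_1 by (simp add: \<phi>_def powr_powr)
  \<comment> \<open>Where \<open>g\<close> is infinite, \<open>enn2real\<close> returns 0 and \<phi>
    has the wrong modulus. This happens on a null set only, which the push-forwards ignore as
    well.\<close>
  have "AE x in M. g x \<noteq> \<infinity>"
    using fin by (intro nn_integral_PInf_AE) auto
  then have AE: "AE x in M. ennreal (norm (\<phi> x) powr p) = g x"
    by eventually_elim (simp add: norm less_top)
  then show "\<phi> \<in> Lp_functions p M"
    using fin by (simp add: Lp_functions_iff nn_integral_cong_AE)
  have "AE x in pushforward n. ennreal (norm (\<phi> x) powr p) = g x"
    by (rule absolutely_continuous_AE[OF _ absolutely_continuous_pushforward AE]) simp
  then show "Lp_norm p M (orbit n \<phi>) = enn2real (\<integral>\<^sup>+x. g x \<partial>pushforward n) powr (1 / p)"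
    by (simp add: Lp_norm_eq[OF orbit] nn_integral_orbit[OF meas] nn_integral_cong_AE)
qed

text \<open>For \<open>B\<close> of finite positive measure this is the norm of the
  \<open>n\<close>-th iterate at the indicator of \<open>B\<close> scaled to norm 1.\<close>

definition normalized_size :: "'a set \<Rightarrow> nat \<Rightarrow> real" where
  "normalized_size B n = preimage_size p M w f n B / measure M B powr (1 / p)"

lemma pushforward_finite:
  assumes "B \<in> sets M" and "emeasure M B < \<infinity>"
  shows "emeasure (pushforward n) B = ennreal (measure (pushforward n) B)"
proof -
  obtain K where K: "\<And>g n. g \<in> borel_measurable M \<Longrightarrow>
       (\<integral>\<^sup>+x. g x \<partial>pushforward n) \<le> ennreal (K ^ n) * (\<integral>\<^sup>+x. g x \<partial>M)"
    using nn_integral_pushforward_le by blast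
  have "emeasure (pushforward n) B \<le> ennreal (K ^ n) * emeasure M B"
    using K[of "indicator B" n] assms by simp
  also have "\<dots> < \<infinity>" using assms by (simp add: ennreal_mult_less_top)
  finally show ?thesis by (intro emeasure_eq_ennreal_measure) auto
qed

lemma normalized_size_powr:
  assumes "B \<in> sets M"
  shows "normalized_size B n powr p = measure (pushforward n) B / measure M B"
  using p_ge_1 assms by (simp add: normalized_size_def preimage_size_eq powr_divide powr_powr)

lemma normalized_size_growth:
  "\<exists>K\<ge>1. \<forall>n. \<forall>B\<in>sets M. emeasure M B < \<infinity> \<longrightarrow> normalized_size B n \<le> K ^ n"
proof -
  obtain K where "1 \<le> K" and K: "\<And>g n. g \<in> borel_measurable M \<Longrightarrow>
       (\<integral>\<^sup>+x. g x \<partial>pushforward n) \<le> ennreal (K ^ n) * (\<integral>\<^sup>+x. g x \<partial>M)"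
    using nn_integral_pushforward_le by blast
  have "normalized_size B n \<le> K ^ n" if B: "B \<in> sets M" "emeasure M B < \<infinity>" for B n
  proof -
    have "ennreal (measure (pushforward n) B) \<le> ennreal (K ^ n) * ennreal (measure M B)"
      using K[of "indicator B" n] B pushforward_finite[OF B, of n] emeasure_eq_ennreal_measure[of M B]
      by simp
    then have "measure (pushforward n) B \<le> K ^ n * measure M B"
      using \<open>1 \<le> K\<close> by (simp add: ennreal_mult[symmetric])
    \<comment> \<open>For a null set the quotient is 0 by the convention on division.\<close>
    then have "measure (pushforward n) B / measure M B \<le> K ^ n"
      using \<open>1 \<le> K\<close> by (simp add: divide_le_eq zero_less_measure_iff)
    then have "(measure (pushforward n) B / measure M B) powr (1 / p) \<le> (K ^ n) powr (1 / p)"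
      using p_ge_1 by (intro powr_mono2) auto
    \<comment> \<open>Since \<open>K ^ n\<close> is at least 1, the bound for p-th powers also
      bounds the norms themselves.\<close>
    also have "\<dots> \<le> (K ^ n) powr 1"
      using p_ge_1 \<open>1 \<le> K\<close> by (intro powr_mono) auto
    finally show ?thesis
      using \<open>1 \<le> K\<close> B by (simp add: normalized_size_def preimage_size_eq powr_divide)
  qed
  then show ?thesis using \<open>1 \<le> K\<close> by blast
qed

text \<open>Integrating |\<phi>|^p termwise shows that the norm of the \<open>n\<close>-th iterate
  is exactly the l^p norm of the sequence of terms, even if the sets overlap. An l^p norm lies
  between each entry and the sum of all entries.\<close>

lemma superposition_orbit:
  fixes B :: "nat \<Rightarrow> 'a set"
  assumes B [measurable]: "\<And>k. B k \<in> sets M"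
    and pos: "\<And>k. 0 < emeasure M (B k)" and fin: "\<And>k. emeasure M (B k) < \<infinity>"
    and a: "\<And>k. 0 \<le> a k" "summable a"
    and summ: "\<And>n. summable (\<lambda>k. a k * normalized_size (B k) n)"
  obtains \<phi> where "\<phi> \<in> Lp_functions p M"
    "\<And>n k. a k * normalized_size (B k) n \<le> Lp_norm p M (orbit n \<phi>)"
    "\<And>n. Lp_norm p M (orbit n \<phi>) \<le> (\<Sum>k. a k * normalized_size (B k) n)"
proof -
  \<comment> \<open>The \<open>k\<close>-th summand is the p-th power of \<open>a k\<close> times
    the normalised indicator of \<open>B k\<close>; hence the integral of \<open>g\<close> over
    \<mu> is the sum of the \<open>a k powr p\<close>, finite because \<open>a\<close> is summable
    and p is at least 1.\<close>
  define g where "g x = (\<Sum>k. ennreal (a k powr p / measure M (B k)) * indicator (B k) x)" for x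
  have [measurable]: "g \<in> borel_measurable M" unfolding g_def by measurable
  have int: "(\<integral>\<^sup>+x. g x \<partial>N) = (\<Sum>k. ennreal (a k powr p / measure M (B k)) * emeasure N (B k))"
    if "sets N = sets M" for N
  proof -
    have [measurable]: "B k \<in> sets N" for k using that B by simp
    show ?thesis unfolding g_def by (subst nn_integral_suminf) (simp_all add: nn_integral_cmult_indicator)
  qed
  have M_B: "emeasure M (B k) = ennreal (measure M (B k))" "0 < measure M (B k)" for k
    using pos[of k] fin[of k] by (auto simp: emeasure_eq_ennreal_measure zero_less_measure_iff)
  have "(\<integral>\<^sup>+x. g x \<partial>M) = (\<Sum>k. ennreal (a k powr p))"
    unfolding int[OF refl]
    by (intro suminf_cong) (use M_B in \<open>simp add: ennreal_mult[symmetric] less_imp_neq[symmetric]\<close>)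
  also have "\<dots> = ennreal (\<Sum>k. a k powr p)"
    by (rule suminf_ennreal2) (use summable_powr_ge_1[OF a(2,1) p_ge_1] in auto)
  finally have g_fin: "(\<integral>\<^sup>+x. g x \<partial>M) < \<infinity>" by simp
  define \<phi> where "\<phi> x = (of_real (enn2real (g x) powr (1 / p)) :: 'k)" for x
  define v where "v n k = a k * normalized_size (B k) n" for n k
  have v0: "0 \<le> v n k" for n k
    using a(1) by (simp add: v_def normalized_size_def preimage_size_def)
  have v: "summable (v n)" for n using summ by (simp add: v_def[abs_def])
  note v_powr = summable_powr_ge_1[OF v v0 p_ge_1]
  have "(\<integral>\<^sup>+x. g x \<partial>pushforward n) = (\<Sum>k. ennreal (v n k powr p))" for n
    unfolding int[OF sets_pushforward]
  proof (rule suminf_cong)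
    fix k
    show "ennreal (a k powr p / measure M (B k)) * emeasure (pushforward n) (B k) = ennreal (v n k powr p)"
      by (simp add: pushforward_finite[OF B fin] v_def powr_mult normalized_size_powr[OF B] ennreal_mult[symmetric])
  qed
  also have "(\<Sum>k. ennreal (v n k powr p)) = ennreal (\<Sum>k. v n k powr p)" for n
    by (rule suminf_ennreal2) (use v_powr in auto)
  finally have norm: "Lp_norm p M (orbit n \<phi>) = (\<Sum>k. v n k powr p) powr (1 / p)" for n
    using powr_root_orbit(2)[OF _ g_fin, of n] v_powr(1)[of n]
    by (simp add: \<phi>_def[abs_def] suminf_nonneg)
  have root: "(x powr p) powr (1 / p) = x" if "0 \<le> x" for x
    using p_ge_1 that by (simp add: powr_powr)
  show ?thesis
  proof
    show "\<phi> \<in> Lp_functions p M"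
      using powr_root_orbit(1)[OF _ g_fin] by (simp add: \<phi>_def[abs_def])
    show "a k * normalized_size (B k) n \<le> Lp_norm p M (orbit n \<phi>)" for n k
    proof -
      have "v n k powr p \<le> (\<Sum>k. v n k powr p)"
        using sum_le_suminf[OF v_powr(1), of "{k}" n] by simp
      then have "(v n k powr p) powr (1 / p) \<le> (\<Sum>k. v n k powr p) powr (1 / p)"
        using p_ge_1 by (intro powr_mono2) auto
      then have "v n k \<le> Lp_norm p M (orbit n \<phi>)" by (simp only: root[OF v0] norm)
      then show ?thesis by (simp only: v_def)
    qed
    show "Lp_norm p M (orbit n \<phi>) \<le> (\<Sum>k. a k * normalized_size (B k) n)" for n
    proof -
      have "(\<Sum>k. v n k powr p) powr (1 / p) \<le> ((\<Sum>k. v n k) powr p) powr (1 / p)"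
        using p_ge_1 v_powr[of n] by (intro powr_mono2 suminf_nonneg) auto
      also have "\<dots> = (\<Sum>k. v n k)"
        by (intro root suminf_nonneg v v0)
      finally have "Lp_norm p M (orbit n \<phi>) \<le> (\<Sum>k. v n k)" by (simp only: norm)
      then show ?thesis by (simp only: v_def[abs_def])
    qed
  qed
qed

section \<open>The two cases: one irregular indicator, or a sliding hump\<close>

lemma indicator_orbit:
  assumes B [measurable]: "B \<in> sets M" and fin: "emeasure M B < \<infinity>"
  obtains \<phi> where "\<phi> \<in> Lp_functions p M" "\<And>n. Lp_norm p M (orbit n \<phi>) = preimage_size p M w f n B"
proof
  have int: "(\<integral>\<^sup>+x. indicator B x \<partial>M) < \<infinity>" using fin by simp
  note root = powr_root_orbit[OF _ int]
  show "(\<lambda>x. of_real (enn2real (indicator B x) powr (1 / p)) :: 'k) \<in> Lp_functions p M"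
    by (rule root) measurable
  show "Lp_norm p M (orbit n (\<lambda>x. of_real (enn2real (indicator B x) powr (1 / p)))) = preimage_size p M w f n B" for n
    by (simp add: root preimage_size_eq[OF B] measure_def)
qed

lemma mean_Li_Yorke_chaotic_if_unbounded_sizes:
  fixes I :: "'i set" and B :: "'i \<Rightarrow> 'a set"
  assumes B: "\<And>i. i \<in> I \<Longrightarrow> B i \<in> sets M \<and> 0 < emeasure M (B i) \<and> emeasure M (B i) < \<infinity>"
    and liminf: "\<And>i. i \<in> I \<Longrightarrow>
      liminf (\<lambda>N. ereal (mean_upto (\<lambda>n. preimage_size p M w f n (B i)) N)) = 0"
    and unbounded: "\<And>L. \<exists>i\<in>I. \<exists>N. L < mean_upto (normalized_size (B i)) N"
  shows "mean_Li_Yorke_chaotic (Lp_space p M) (Lp_dist p M) (wc_op p M w f)"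
proof (cases "\<exists>i\<in>I. 0 < limsup (\<lambda>N. ereal (mean_upto (\<lambda>n. preimage_size p M w f n (B i)) N))")
  case True
  then obtain i where i: "i \<in> I"
    and limsup: "0 < limsup (\<lambda>N. ereal (mean_upto (\<lambda>n. preimage_size p M w f n (B i)) N))" by blast
  obtain \<phi> where "\<phi> \<in> Lp_functions p M"
    "\<And>n. Lp_norm p M (orbit n \<phi>) = preimage_size p M w f n (B i)"
    using indicator_orbit[of "B i"] B[OF i] by blast
  then show ?thesis
    using mean_Li_Yorke_chaotic_if_semi_irregular[of \<phi>] liminf[OF i] limsup by simp
next
  case False
  have vanishing: "mean_upto (normalized_size (B i)) \<longlonglongrightarrow> 0" if i: "i \<in> I" for i
  proof -
    let ?X = "mean_upto (\<lambda>n. preimage_size p M w f n (B i))"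
    have "limsup (\<lambda>N. ereal (?X N)) \<le> 0" using False i by (auto simp: not_less)
    moreover have "liminf (\<lambda>N. ereal (?X N)) \<le> limsup (\<lambda>N. ereal (?X N))"
      by (rule Liminf_le_Limsup) simp
    ultimately have "(\<lambda>N. ereal (?X N)) \<longlonglongrightarrow> 0"
      using liminf[OF i] by (subst tendsto_iff_Liminf_eq_Limsup) auto
    then have "?X \<longlonglongrightarrow> 0" by (simp add: zero_ereal_def)
    \<comment> \<open>Normalising is harmless for each single \<open>i\<close>. The convergence need
      not be uniform in \<open>i\<close>, which leaves room for the unbounded means.\<close>
    then have "(\<lambda>N. (1 / measure M (B i) powr (1 / p)) * ?X N) \<longlonglongrightarrow> (1 / measure M (B i) powr (1 / p)) * 0"
      by (rule tendsto_mult_left)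
    then show ?thesis
      using mean_upto_cmult[of "1 / measure M (B i) powr (1 / p)" "\<lambda>n. preimage_size p M w f n (B i)"]
      by (simp add: normalized_size_def[abs_def])
  qed
  obtain K where K: "1 \<le> K"
    "\<And>n B. B \<in> sets M \<Longrightarrow> emeasure M B < \<infinity> \<Longrightarrow> normalized_size B n \<le> K ^ n"
    using normalized_size_growth by blast
  have nonneg: "0 \<le> normalized_size (B i) n" for i n
    by (simp add: normalized_size_def preimage_size_def)
  have growth: "normalized_size (B i) n \<le> K ^ n" if "i \<in> I" for i n
    using K(2) B[OF that] by blast
  show ?thesis
  proof (rule sliding_hump[of I "\<lambda>i. normalized_size (B i)", OF nonneg growth K(1) vanishing unbounded])
    fix i :: "nat \<Rightarrow> 'i" and a :: "nat \<Rightarrow> real"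
    assume i: "\<And>k. i k \<in> I" and a: "\<And>k. 0 \<le> a k"
      and summ: "\<And>n. summable (\<lambda>k. a k * normalized_size (B (i k)) n)" "summable a"
      and irregular: "\<And>r. \<lbrakk>\<And>n k. a k * normalized_size (B (i k)) n \<le> r n;
          \<And>n. r n \<le> (\<Sum>k. a k * normalized_size (B (i k)) n)\<rbrakk> \<Longrightarrow>
        liminf (\<lambda>N. ereal (mean_upto r N)) = 0 \<and> 1 \<le> limsup (\<lambda>N. ereal (mean_upto r N))"
    obtain \<phi> where \<phi>: "\<phi> \<in> Lp_functions p M"
      "\<And>n k. a k * normalized_size (B (i k)) n \<le> Lp_norm p M (orbit n \<phi>)"
      "\<And>n. Lp_norm p M (orbit n \<phi>) \<le> (\<Sum>k. a k * normalized_size (B (i k)) n)"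
      using superposition_orbit[of "\<lambda>k. B (i k)" a] B[OF i] a summ by blast
    have irr: "liminf (\<lambda>N. ereal (mean_upto (\<lambda>n. Lp_norm p M (orbit n \<phi>)) N)) = 0 \<and>
      1 \<le> limsup (\<lambda>N. ereal (mean_upto (\<lambda>n. Lp_norm p M (orbit n \<phi>)) N))"
      by (rule irregular) (rule \<phi>)+
    show ?thesis
    proof (rule mean_Li_Yorke_chaotic_if_semi_irregular[OF \<phi>(1)])
      show "liminf (\<lambda>N. ereal (mean_upto (\<lambda>n. Lp_norm p M (orbit n \<phi>)) N)) = 0"
        using irr by (rule conjunct1)
      have "(0::ereal) < 1" by simp
      also have "1 \<le> limsup (\<lambda>N. ereal (mean_upto (\<lambda>n. Lp_norm p M (orbit n \<phi>)) N))"
        using irr by (rule conjunct2)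
      finally show "0 < limsup (\<lambda>N. ereal (mean_upto (\<lambda>n. Lp_norm p M (orbit n \<phi>)) N))" .
    qed
  qed
qed

end

theorem theorem68:
  fixes p :: real
    and M :: "'a measure"
    and w :: "'a \<Rightarrow> 'k::{real_normed_field, euclidean_space}"
    and f :: "'a \<Rightarrow> 'a"
    and I :: "'i set"
    and B :: "'i \<Rightarrow> 'a set"
  assumes "weighted_composition p M w f"
    and "I \<noteq> {}" and "countable I"
    and "\<And>i. i \<in> I \<Longrightarrow> B i \<in> sets M \<and> 0 < emeasure M (B i) \<and> emeasure M (B i) < \<infinity>"
    and "\<And>i. i \<in> I \<Longrightarrow>
           liminf (\<lambda>N. ereal ((\<Sum>n=1..N. preimage_size p M w f n (B i)) / real N)) = 0"
    and "(SUP (i, N) \<in> I \<times> {1::nat..}.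
           ereal ((\<Sum>n=1..N. preimage_size p M w f n (B i) / measure M (B i) powr (1 / p)) / real N)) = \<infinity>"
  shows "mean_Li_Yorke_chaotic (Lp_space p M) (Lp_dist p M) (wc_op p M w f)"
proof -
  interpret weighted_composition p M w f by (rule assms(1))
  show ?thesis
  proof (rule mean_Li_Yorke_chaotic_if_unbounded_sizes[of I B])
    show "\<exists>i\<in>I. \<exists>N. L < mean_upto (normalized_size (B i)) N" for L
    proof -
      have "ereal L < (SUP (i, N) \<in> I \<times> {1::nat..}.
           ereal ((\<Sum>n=1..N. preimage_size p M w f n (B i) / measure M (B i) powr (1 / p)) / real N))"
        unfolding assms(6) by simp
      then show ?thesis
        unfolding less_SUP_iff mean_upto_def normalized_size_def by auto
    qed
  qed (use assms(4,5) in \<open>simp_all add: mean_upto_def\<close>)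
qed

end
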